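(* For any finite coloring of $\mathbb{N}$ there exist infinitely many pairs $(x,y)\in\mathbb{N}^2$ such that the set $\{x,xy,x+y\}$ is monochromatic.
   Context: $\mathbb{N}=\{1,2,\dots\}$. A finite coloring of $\mathbb{N}$ is a finite partition $\mathbb{N}=C_1\cup\cdots\cup C_r$; a set is monochromatic if it is contained in a single cell $C_t$. *)

theory Defs
  imports Main "HOL-Library.Disjoint_Sets"
begin

(* The natural numbers here start at 1, so the coloured set is {1..} :: nat set.
   Cells may be empty. *)
definition finite_coloring :: "nat \<Rightarrow> (nat \<Rightarrow> nat set) \<Rightarrow> bool" where
  "finite_coloring r C \<longleftrightarrow> (\<Union>t\<in>{1..r}. C t) = {1..} \<and> disjoint_family_on C {1..r}"

definition monochromatic :: "nat \<Rightarrow> (nat \<Rightarrow> nat set) \<Rightarrow> nat set \<Rightarrow> bool" where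
  "monochromatic r C A \<longleftrightarrow> (\<exists>t\<in>{1..r}. A \<subseteq> C t)"

end

theory Submission
  imports Defs
begin

text \<open>
  The argument runs inside sets that are piecewise syndetic: large enough to be infinite, yet stable
  under the three operations that are needed. If such a set is cut into finitely many pieces, one piece is again piecewise syndetic
  (\<open>piecewise_syndetic_UN\<close>); its dilates are piecewise syndetic (\<open>piecewise_syndetic_dilate\<close>); and for
  each \<open>l\<close> there is one common difference \<open>y > 0\<close> for which the starting points of the progressions
  \<open>x, x + y, \<dots>, x + l y\<close> inside the set are piecewise syndetic (\<open>piecewise_syndetic_progressions\<close>).
  The last property is a uniform form of van der Waerden's theorem, which is proved first by the
  usual colour focusing.

  Following Moreira, build piecewise syndetic sets \<open>B\<^sub>0, B\<^sub>1, \<dots>\<close>, each inside one colour, and numbers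
  \<open>y\<^sub>1, y\<^sub>2, \<dots>\<close>: pick \<open>y\<^sub>k\<close> such that the set \<open>D\<close> of all \<open>x\<close> with \<open>x + j y\<^sub>k \<in> B\<^sub>k\<^sub>-\<^sub>1\<close>
  for every \<open>j \<le> (y\<^sub>1 \<cdots> y\<^sub>k\<^sub>-\<^sub>1)\<^sup>2\<close> is piecewise syndetic, dilate \<open>D\<close> by \<open>y\<^sub>k\<close>, and let \<open>B\<^sub>k\<close> be a
  piecewise syndetic colour class of the dilate. Two of these sets, \<open>B\<^sub>i\<close> and \<open>B\<^sub>k\<close> with \<open>i < k\<close>,
  have the same colour. Put \<open>u = y\<^sub>i\<^sub>+\<^sub>1 \<cdots> y\<^sub>k\<^sub>-\<^sub>1\<close> and \<open>Y = u y\<^sub>k\<close>. Every \<open>z \<in> B\<^sub>k\<close> is \<open>x Y\<close> with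
  \<open>x \<in> B\<^sub>i\<close>, and \<open>u x + u\<^sup>2 y\<^sub>k = u (x + Y)\<close> lies in \<open>B\<^sub>k\<^sub>-\<^sub>1 \<subseteq> u B\<^sub>i\<close>, so that \<open>x + Y \<in> B\<^sub>i\<close> as well. Thus
  \<open>x\<close>, \<open>x Y\<close> and \<open>x + Y\<close> have one colour, and the infinitely many \<open>z \<in> B\<^sub>k\<close> yield infinitely many pairs.
\<close>

section \<open>Van der Waerden's theorem\<close>

text \<open>
  The bound leaves room for one more term after the \<open>l + 1\<close> monochromatic ones. In the
  induction on \<open>l\<close> that free term becomes the focus.
\<close>

definition vdW :: "nat \<Rightarrow> nat \<Rightarrow> nat \<Rightarrow> bool" where
  "vdW r l N \<longleftrightarrow> (\<forall>\<chi>::nat \<Rightarrow> nat. (\<forall>x. \<chi> x < r) \<longrightarrow>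
     (\<exists>a d. 0 < d \<and> a + Suc l * d < N \<and> (\<forall>j\<le>l. \<chi> (a + j * d) = \<chi> a)))"

text \<open>
  Cutting the line into blocks of length \<open>N\<close> and colouring each block by its whole colour pattern
  is a colouring with finitely many colours, so blocks with equal patterns occur in progression.
\<close>

lemma vdW_blocks:
  assumes "\<And>r. \<exists>N. vdW r l N"
  shows "\<exists>M. \<forall>\<chi>::nat \<Rightarrow> nat. (\<forall>x. \<chi> x < r) \<longrightarrow>
    (\<exists>b e. 0 < e \<and> b + Suc l * e < M \<and> (\<forall>j\<le>l. \<forall>x<N. \<chi> ((b + j * e) * N + x) = \<chi> (b * N + x)))"
proof -
  define W where "W = {xs. set xs \<subseteq> {..<r} \<and> length xs = N}"
  have "finite W"
    unfolding W_def by (rule finite_lists_length_eq) simp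
  then obtain h where h: "bij_betw h W {0..<card W}"
    using ex_bij_betw_finite_nat by blast
  obtain M where M: "vdW (card W) l M"
    using assms by blast
  have "\<exists>b e. 0 < e \<and> b + Suc l * e < M \<and> (\<forall>j\<le>l. \<forall>x<N. \<chi> ((b + j * e) * N + x) = \<chi> (b * N + x))"
    if \<chi>: "\<forall>x. \<chi> x < r" for \<chi> :: "nat \<Rightarrow> nat"
  proof -
    define w where "w b = map (\<lambda>x. \<chi> (b * N + x)) [0..<N]" for b
    have w: "w b \<in> W" for b
      using \<chi> by (auto simp: w_def W_def)
    have "\<forall>b. h (w b) < card W"
      using h w by (auto simp: bij_betw_def)
    then obtain b e where be: "0 < e" "b + Suc l * e < M" "\<forall>j\<le>l. h (w (b + j * e)) = h (w b)"
      using M unfolding vdW_def by (elim allE[of _ "\<lambda>b. h (w b)"]) blast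
    have "\<chi> ((b + j * e) * N + x) = \<chi> (b * N + x)" if "j \<le> l" "x < N" for j x
    proof -
      have "w (b + j * e) = w b"
        using be(3) that(1) w h unfolding bij_betw_def by (metis inj_onD)
      then have "w (b + j * e) ! x = w b ! x"
        by simp
      then show ?thesis
        using that(2) by (simp add: w_def)
    qed
    then show ?thesis
      using be by blast
  qed
  then show ?thesis
    by blast
qed

text \<open>
  Colour focusing: unless there already is a monochromatic progression with \<open>l + 2\<close> terms, there
  are \<open>m\<close> progressions with \<open>l + 1\<close> terms, of pairwise different colours, whose next term is the
  same point \<open>f\<close>. To get one more progression, find such a system inside each of several blocks that
  have the same pattern and are in progression: adding the block distance to every difference moves
  the focus into the block that continues the progression of blocks, and the old foci form the new
  progression.
\<close>

lemma colour_focusing: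
  fixes m :: nat
  assumes "\<And>r. \<exists>N. vdW r l N"
  shows "\<exists>N. \<forall>\<chi>::nat \<Rightarrow> nat. (\<forall>x. \<chi> x < r) \<longrightarrow>
    (\<exists>a d. 0 < d \<and> a + Suc l * d < N \<and> (\<forall>j\<le>Suc l. \<chi> (a + j * d) = \<chi> a)) \<or>
    (\<exists>f<N. \<exists>a d. (\<forall>i<m. 0 < d i \<and> a i + Suc l * d i = f \<and> (\<forall>j\<le>l. \<chi> (a i + j * d i) = \<chi> (a i)))
       \<and> inj_on (\<lambda>i. \<chi> (a i)) {..<m})"
    (is "\<exists>N. \<forall>\<chi>. _ \<longrightarrow> ?mono N \<chi> \<or> ?foc N \<chi> m")
proof (induction m)
  case 0
  show ?case by (rule exI[of _ 1]) auto
next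
  case (Suc m)
  then obtain N where N: "\<And>\<chi>. \<forall>x. \<chi> x < r \<Longrightarrow> ?mono N \<chi> \<or> ?foc N \<chi> m"
    by blast
  obtain M where M: "\<And>\<chi>::nat \<Rightarrow> nat. \<forall>x. \<chi> x < r \<Longrightarrow>
    \<exists>b e. 0 < e \<and> b + Suc l * e < M \<and> (\<forall>j\<le>l. \<forall>x<N. \<chi> ((b + j * e) * N + x) = \<chi> (b * N + x))"
    using vdW_blocks[OF assms, where r = r and N = N] by blast
  have "?mono (M * N) \<chi> \<or> ?foc (M * N) \<chi> (Suc m)" if \<chi>: "\<forall>x. \<chi> x < r" for \<chi> :: "nat \<Rightarrow> nat"
  proof -
    obtain b e where e: "0 < e" and be: "b + Suc l * e < M"
      and blocks: "\<And>j x. j \<le> l \<Longrightarrow> x < N \<Longrightarrow> \<chi> ((b + j * e) * N + x) = \<chi> (b * N + x)"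
      using M[OF \<chi>] by blast
    have inside: "c * N + x < M * N" if "c < M" "x < N" for c x
    proof -
      have "c * N + x < Suc c * N" using that by simp
      also have "\<dots> \<le> M * N" using that by (intro mult_right_mono) auto
      finally show ?thesis .
    qed
    have b: "b < M" using be by simp
    define \<chi>' where "\<chi>' x = \<chi> (b * N + x)" for x
    consider (mono) "?mono N \<chi>'" | (foc) "?foc N \<chi>' m"
      using N[of \<chi>'] \<chi> unfolding \<chi>'_def by blast
    then show ?thesis
    proof cases
      case mono
      then obtain a d where "0 < d" "a + Suc l * d < N" "\<forall>j\<le>Suc l. \<chi>' (a + j * d) = \<chi>' a"
        by blast
      then have "0 < d \<and> (b * N + a) + Suc l * d < M * N \<and>
          (\<forall>j\<le>Suc l. \<chi> ((b * N + a) + j * d) = \<chi> (b * N + a))"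
        using inside[OF b, of "a + Suc l * d"] by (simp add: \<chi>'_def add.assoc)
      then show ?thesis by blast
    next
      case foc
      then obtain f a d where f: "f < N"
        and ad: "\<And>i. i < m \<Longrightarrow> 0 < d i" "\<And>i. i < m \<Longrightarrow> a i + Suc l * d i = f"
          "\<And>i j. i < m \<Longrightarrow> j \<le> l \<Longrightarrow> \<chi>' (a i + j * d i) = \<chi>' (a i)"
        and inj: "inj_on (\<lambda>i. \<chi>' (a i)) {..<m}"
        by blast
      show ?thesis
      proof (cases "\<exists>i<m. \<chi>' f = \<chi>' (a i)")
        case True
        then obtain i where i: "i < m" "\<chi>' f = \<chi>' (a i)" by blast
        have "\<chi>' (a i + j * d i) = \<chi>' (a i)" if "j \<le> Suc l" for j
          using that ad(2,3)[OF i(1)] i(2) by (cases "j = Suc l") auto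
        then have "0 < d i \<and> (b * N + a i) + Suc l * d i < M * N \<and>
            (\<forall>j\<le>Suc l. \<chi> ((b * N + a i) + j * d i) = \<chi> (b * N + a i))"
          using inside[OF b f] ad(1,2)[OF i(1)] by (simp add: \<chi>'_def add.assoc)
        then show ?thesis by blast
      next
        case False
        define F where "F = (b + Suc l * e) * N + f"
        define a' where "a' i = b * N + (if i = m then f else a i)" for i
        define d' where "d' i = e * N + (if i = m then 0 else d i)" for i
        have "F < M * N"
          unfolding F_def using inside[OF be f] .
        moreover have "0 < d' i \<and> a' i + Suc l * d' i = F \<and> (\<forall>j\<le>l. \<chi> (a' i + j * d' i) = \<chi> (a' i))"
          if "i < Suc m" for i
        proof (cases "i = m")
          case True
          then show ?thesis
            using e f blocks[OF _ f] by (simp add: F_def a'_def d'_def algebra_simps)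
        next
          case False
          then have i: "i < m" using that by simp
          have "\<chi> (a' i + j * d' i) = \<chi> (a' i)" if j: "j \<le> l" for j
          proof -
            have "j * d i \<le> Suc l * d i"
              using j by (intro mult_right_mono) auto
            then have "a i + j * d i < N"
              using ad(2)[OF i] f by linarith
            moreover have "a' i + j * d' i = (b + j * e) * N + (a i + j * d i)"
              using False by (simp add: a'_def d'_def algebra_simps)
            ultimately have "\<chi> (a' i + j * d' i) = \<chi>' (a i + j * d i)"
              using blocks[OF j] by (simp add: \<chi>'_def)
            then show ?thesis
              using ad(3)[OF i j] False by (simp add: \<chi>'_def a'_def)
          qed
          moreover have "a' i + Suc l * d' i = F"
            using False ad(2)[OF i] by (simp add: F_def a'_def d'_def algebra_simps)
          ultimately show ?thesis
            using False ad(1)[OF i] by (simp add: d'_def)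
        qed
        moreover have "inj_on (\<lambda>i. \<chi> (a' i)) {..<Suc m}"
        proof -
          have "\<chi> (a' m) = \<chi>' f" and old: "\<And>i. i < m \<Longrightarrow> \<chi> (a' i) = \<chi>' (a i)"
            by (simp_all add: a'_def \<chi>'_def)
          then have "\<chi> (a' m) \<notin> (\<lambda>i. \<chi> (a' i)) ` {..<m}"
            using False by force
          moreover have "inj_on (\<lambda>i. \<chi> (a' i)) {..<m}"
            using inj old inj_on_cong[of "{..<m}" "\<lambda>i. \<chi> (a' i)" "\<lambda>i. \<chi>' (a i)"] by simp
          ultimately show ?thesis
            by (simp add: lessThan_Suc)
        qed
        ultimately show ?thesis by blast
      qed
    qed
  qed
  then show ?case by blast
qed

text \<open>With \<open>r\<close> colours there is no focused system of \<open>r + 1\<close> differently coloured progressions.\<close>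

theorem van_der_Waerden: "\<exists>N. vdW r l N"
proof (induction l arbitrary: r)
  case 0
  have "vdW r 0 2"
    unfolding vdW_def by (intro allI impI exI[of _ 0] exI[of _ 1]) simp
  then show ?case ..
next
  case (Suc l)
  obtain N where N: "\<And>\<chi>::nat \<Rightarrow> nat. \<forall>x. \<chi> x < r \<Longrightarrow>
    (\<exists>a d. 0 < d \<and> a + Suc l * d < N \<and> (\<forall>j\<le>Suc l. \<chi> (a + j * d) = \<chi> a)) \<or>
    (\<exists>f<N. \<exists>a d. (\<forall>i<Suc r. 0 < d i \<and> a i + Suc l * d i = f \<and> (\<forall>j\<le>l. \<chi> (a i + j * d i) = \<chi> (a i)))
       \<and> inj_on (\<lambda>i. \<chi> (a i)) {..<Suc r})"
    using colour_focusing[OF Suc.IH, where r = r and m = "Suc r"] by blast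
  \<comment> \<open>Doubling makes room for the free term, since a progression inside \<open>{..<N}\<close> has difference
    less than \<open>N\<close>.\<close>
  have "vdW r (Suc l) (2 * N)"
    unfolding vdW_def
  proof (intro allI impI)
    fix \<chi> :: "nat \<Rightarrow> nat"
    assume \<chi>: "\<forall>x. \<chi> x < r"
    have "\<not> inj_on (\<lambda>i. \<chi> (a i)) {..<Suc r}" for a
    proof
      assume "inj_on (\<lambda>i. \<chi> (a i)) {..<Suc r}"
      then have "card {..<Suc r} \<le> card {..<r}"
        by (rule card_inj_on_le) (use \<chi> in auto)
      then show False by simp
    qed
    then obtain a d where ad: "0 < d" "a + Suc l * d < N" "\<forall>j\<le>Suc l. \<chi> (a + j * d) = \<chi> a"
      using N[OF \<chi>] by blast
    then have "a + Suc (Suc l) * d < 2 * N"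
      by simp
    then show "\<exists>a d. 0 < d \<and> a + Suc (Suc l) * d < 2 * N \<and> (\<forall>j\<le>Suc l. \<chi> (a + j * d) = \<chi> a)"
      using ad by blast
  qed
  then show ?case ..
qed

section \<open>Piecewise syndetic sets\<close>

text \<open>Boundedly many backward translates of the set cover arbitrarily long intervals.\<close>

definition piecewise_syndetic :: "nat set \<Rightarrow> bool" where
  "piecewise_syndetic A \<longleftrightarrow> (\<exists>g. \<forall>n. \<exists>t. \<forall>s\<in>{t..<t + n}. \<exists>h\<le>g. s + h \<in> A)"

lemma piecewise_syndetic_mono:
  assumes "piecewise_syndetic A" "A \<subseteq> B"
  shows "piecewise_syndetic B"
  using assms unfolding piecewise_syndetic_def by (meson subsetD)

lemma piecewise_syndetic_atLeast: "piecewise_syndetic {m..}"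
  unfolding piecewise_syndetic_def by (intro exI[of _ 0] allI exI[of _ m]) auto

lemma piecewise_syndetic_imp_infinite:
  assumes "piecewise_syndetic A"
  shows "infinite A"
proof
  assume "finite A"
  then obtain m where m: "\<And>x. x \<in> A \<Longrightarrow> x < m"
    using finite_nat_set_iff_bounded by auto
  obtain g t where "\<forall>s\<in>{t..<t + Suc m}. \<exists>h\<le>g. s + h \<in> A"
    using assms unfolding piecewise_syndetic_def by meson
  then obtain h where "t + m + h \<in> A"
    by fastforce
  then show False
    using m by fastforce
qed

text \<open>
  If \<open>B\<close> is not piecewise syndetic, then for the gap bound \<open>g\<close> of \<open>A \<union> B\<close> every interval of some
  length \<open>L\<close> contains a point that sees no element of \<open>B\<close> within \<open>g\<close>. On the intervals where
  \<open>A \<union> B\<close> is dense that point must see an element of \<open>A\<close>.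
\<close>

lemma piecewise_syndetic_Un:
  assumes "piecewise_syndetic (A \<union> B)"
  shows "piecewise_syndetic A \<or> piecewise_syndetic B"
proof (rule disjCI)
  assume nB: "\<not> piecewise_syndetic B"
  obtain g where g: "\<And>n. \<exists>t. \<forall>s\<in>{t..<t + n}. \<exists>h\<le>g. s + h \<in> A \<union> B"
    using assms unfolding piecewise_syndetic_def by blast
  obtain L where L: "\<And>t. \<exists>s\<in>{t..<t + L}. \<forall>h\<le>g. s + h \<notin> B"
    using nB unfolding piecewise_syndetic_def by meson
  have "\<exists>t. \<forall>s\<in>{t..<t + n}. \<exists>h\<le>g + L. s + h \<in> A" for n
  proof -
    obtain t where t: "\<forall>s\<in>{t..<t + (n + L)}. \<exists>h\<le>g. s + h \<in> A \<union> B"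
      using g by blast
    have "\<exists>h\<le>g + L. s + h \<in> A" if s: "s \<in> {t..<t + n}" for s
    proof -
      obtain s' where s': "s' \<in> {s..<s + L}" "\<forall>h\<le>g. s' + h \<notin> B"
        using L by blast
      then have "s' \<in> {t..<t + (n + L)}"
        using s by auto
      then obtain h where "h \<le> g" "s' + h \<in> A"
        using t s'(2) by blast
      then show ?thesis
        using s' by (intro exI[of _ "s' - s + h"]) auto
    qed
    then show ?thesis by blast
  qed
  then show "piecewise_syndetic A"
    unfolding piecewise_syndetic_def by blast
qed

lemma piecewise_syndetic_UN:
  assumes "finite I" "piecewise_syndetic (\<Union>i\<in>I. A i)"
  shows "\<exists>i\<in>I. piecewise_syndetic (A i)"
  using assms
proof (induction I)
  case empty
  then show ?case
    using piecewise_syndetic_imp_infinite by fastforce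
next
  case (insert i I)
  then have "piecewise_syndetic (A i) \<or> piecewise_syndetic (\<Union>i\<in>I. A i)"
    by (intro piecewise_syndetic_Un) simp
  then show ?case
    using insert.IH by blast
qed

lemma piecewise_syndetic_dilate:
  assumes "piecewise_syndetic A" "0 < y"
  shows "piecewise_syndetic ((*) y ` A)"
proof -
  obtain g where g: "\<And>n. \<exists>t. \<forall>s\<in>{t..<t + n}. \<exists>h\<le>g. s + h \<in> A"
    using assms(1) unfolding piecewise_syndetic_def by blast
  \<comment> \<open>Besides the dilated gap \<open>y * g\<close>, rounding up to a multiple of \<open>y\<close> costs at most \<open>y\<close>.\<close>
  have "\<exists>t. \<forall>s\<in>{t..<t + n}. \<exists>h\<le>y * Suc g. s + h \<in> (*) y ` A" for n
  proof -
    obtain t where t: "\<forall>s\<in>{t..<t + (n + 2)}. \<exists>h\<le>g. s + h \<in> A"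
      using g by blast
    have "\<exists>h\<le>y * Suc g. s + h \<in> (*) y ` A" if s: "s \<in> {y * t..<y * t + n}" for s
    proof -
      define q where "q = s div y"
      have "t \<le> q"
        using s assms(2) by (simp add: q_def less_eq_div_iff_mult_less_eq mult.commute)
      moreover have "q \<le> t + n"
      proof -
        have "s \<le> y * (t + n)"
          using s assms(2) by (auto simp: algebra_simps intro: order.trans[OF less_imp_le])
        then show ?thesis
          unfolding q_def using assms(2)
          by (metis div_le_mono nonzero_mult_div_cancel_left less_numeral_extra(3))
      qed
      ultimately have "Suc q \<in> {t..<t + (n + 2)}"
        by simp
      then obtain h where h: "h \<le> g" "Suc q + h \<in> A"
        using t by blast
      have "s = y * q + s mod y" "s mod y < y"
        using assms(2) by (simp_all add: q_def)
      moreover have "y * h \<le> y * g"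
        using h(1) by simp
      moreover have "y * (Suc q + h) = y * q + y + y * h" "y * Suc g = y + y * g"
        by (simp_all add: algebra_simps)
      ultimately have "s \<le> y * (Suc q + h)" "y * (Suc q + h) - s \<le> y * Suc g"
        by linarith+
      then show ?thesis
        using imageI[OF h(2), of "(*) y"]
        by (intro exI[of _ "y * (Suc q + h) - s"]) (simp only: le_add_diff_inverse simp_thms)
    qed
    then show ?thesis by blast
  qed
  then show ?thesis
    unfolding piecewise_syndetic_def by blast
qed

text \<open>
  Colour each point of a long well covered interval by its distance to some element of the set that
  lies at most \<open>g\<close> further on: a monochromatic progression, translated by its colour, lies in the
  set. The van der Waerden bound \<open>N\<close> limits the possible differences, so finitely many of the sets
  \<open>{x. \<forall>j\<le>l. x + j * y \<in> A}\<close> have a piecewise syndetic union.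
\<close>

lemma piecewise_syndetic_progressions:
  assumes "piecewise_syndetic A"
  shows "\<exists>y>0. piecewise_syndetic {x. \<forall>j\<le>l. x + j * y \<in> A}"
proof -
  define E where "E y = {x. \<forall>j\<le>l. x + j * y \<in> A}" for y
  obtain g where g: "\<And>n. \<exists>t. \<forall>s\<in>{t..<t + n}. \<exists>h\<le>g. s + h \<in> A"
    using assms unfolding piecewise_syndetic_def by blast
  obtain N where N: "vdW (Suc g) l N"
    using van_der_Waerden by blast
  have "\<exists>t. \<forall>s\<in>{t..<t + n}. \<exists>h\<le>N + g. s + h \<in> (\<Union>y\<in>{1..N}. E y)" for n
  proof -
    obtain t where t: "\<forall>s\<in>{t..<t + (n + N)}. \<exists>h\<le>g. s + h \<in> A"
      using g by blast
    have "\<exists>h\<le>N + g. s + h \<in> (\<Union>y\<in>{1..N}. E y)" if s: "s \<in> {t..<t + n}" for s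
    proof -
      have "\<exists>h\<le>g. u < N \<longrightarrow> s + u + h \<in> A" for u
        using t s by (cases "u < N") auto
      then obtain \<chi> where \<chi>: "\<And>u. \<chi> u \<le> g" "\<And>u. u < N \<Longrightarrow> s + u + \<chi> u \<in> A"
        by metis
      obtain a d where ad: "0 < d" "a + Suc l * d < N" "\<forall>j\<le>l. \<chi> (a + j * d) = \<chi> a"
        using N \<chi>(1) unfolding vdW_def by (elim allE[of _ \<chi>]) (auto simp: less_Suc_eq_le)
      have "s + (a + \<chi> a) + j * d \<in> A" if j: "j \<le> l" for j
      proof -
        have "j * d \<le> Suc l * d"
          using j by (intro mult_right_mono) auto
        then have "s + (a + j * d) + \<chi> (a + j * d) \<in> A"
          using \<chi>(2) ad(2) by simp
        then show ?thesis
          using ad(3) j by (simp add: add_ac)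
      qed
      then have "s + (a + \<chi> a) \<in> E d"
        by (simp add: E_def)
      moreover have "d \<in> {1..N}" "a + \<chi> a \<le> N + g"
        using ad(1,2) \<chi>(1)[of a] by auto
      ultimately show ?thesis by blast
    qed
    then show ?thesis by blast
  qed
  then have "piecewise_syndetic (\<Union>y\<in>{1..N}. E y)"
    unfolding piecewise_syndetic_def by blast
  then obtain y where "y \<in> {1..N}" "piecewise_syndetic (E y)"
    using piecewise_syndetic_UN by blast
  then show ?thesis
    unfolding E_def by (intro exI[of _ y]) auto
qed

section \<open>Monochromatic sums and products\<close>

text \<open>
  One step of the construction. The number \<open>P\<close> is the product of the multipliers chosen so far; all
  squares \<open>u\<^sup>2\<close> of partial products \<open>u\<close> that will be needed are at most \<open>P\<^sup>2\<close>, so a single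
  progression length serves them all.
\<close>

lemma dilated_progressions_in_cell:
  fixes r P :: nat and C :: "nat \<Rightarrow> nat set"
  assumes col: "(\<Union>t\<in>{1..r}. C t) = {1..}"
    and B: "piecewise_syndetic B" "B \<subseteq> {1..}"
  shows "\<exists>y>0. \<exists>t\<in>{1..r}. \<exists>B'\<subseteq>C t. piecewise_syndetic B' \<and>
    (\<forall>z\<in>B'. \<exists>x. z = x * y \<and> (\<forall>j\<le>P\<^sup>2. x + j * y \<in> B))"
proof -
  obtain y where y: "0 < y" "piecewise_syndetic {x. \<forall>j\<le>P\<^sup>2. x + j * y \<in> B}"
      (is "piecewise_syndetic ?D")
    using piecewise_syndetic_progressions[OF B(1)] by blast
  have "?D \<subseteq> {1..}"
    using B(2) by (auto dest: spec[of _ 0])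
  then have "(*) y ` ?D \<subseteq> (\<Union>t\<in>{1..r}. C t)"
    using y(1) unfolding col by (auto simp: Suc_le_eq)
  then have "(*) y ` ?D \<subseteq> (\<Union>t\<in>{1..r}. C t \<inter> (*) y ` ?D)"
    by blast
  then have "piecewise_syndetic (\<Union>t\<in>{1..r}. C t \<inter> (*) y ` ?D)"
    by (rule piecewise_syndetic_mono[OF piecewise_syndetic_dilate[OF y(2,1)]])
  then obtain t where "t \<in> {1..r}" "piecewise_syndetic (C t \<inter> (*) y ` ?D)"
    using piecewise_syndetic_UN[OF finite_atLeastAtMost] by blast
  then show ?thesis
    using y(1) by (intro exI[of _ y] conjI bexI[of _ t] exI[of _ "C t \<inter> (*) y ` ?D"])
      (auto simp: mult.commute)
qed

text \<open>
  The induction on \<open>k\<close> rests on the bound \<open>(P k)\<^sup>2\<close>: the multiplier \<open>u\<close> from stage \<open>i\<close> to stage \<open>k\<close>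
  divides \<open>P k\<close>, so \<open>j = u\<^sup>2\<close> is admissible in the next step, and there
  \<open>u x + u\<^sup>2 y = u (x + u y)\<close> can be divided by \<open>u\<close>.
\<close>

lemma sum_product_between_stages:
  fixes B :: "nat \<Rightarrow> nat set" and P :: "nat \<Rightarrow> nat"
  assumes pos: "\<And>k. 0 < P k"
    and step: "\<And>k. \<exists>y>0. P (Suc k) = P k * y \<and>
      (\<forall>z\<in>B (Suc k). \<exists>x. z = x * y \<and> (\<forall>j\<le>(P k)\<^sup>2. x + j * y \<in> B k))"
    and "i < k"
  shows "\<exists>Y>0. P k = P i * Y \<and> (\<forall>z\<in>B k. \<exists>x\<in>B i. z = x * Y \<and> x + Y \<in> B i)"
proof -
  \<comment> \<open>The hypothesis speaks of the product only, so it also holds for \<open>k = i\<close> with \<open>u = 1\<close>, where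
    nothing is known about sums; this gives the base case.\<close>
  have extend: "\<exists>Y>0. P (Suc k) = P i * Y \<and> (\<forall>z\<in>B (Suc k). \<exists>x\<in>B i. z = x * Y \<and> x + Y \<in> B i)"
    if u: "0 < u" "P k = P i * u" "\<forall>z\<in>B k. \<exists>x\<in>B i. z = x * u" for u k
  proof -
    obtain y where y: "0 < y" "P (Suc k) = P k * y"
      "\<forall>z\<in>B (Suc k). \<exists>x. z = x * y \<and> (\<forall>j\<le>(P k)\<^sup>2. x + j * y \<in> B k)"
      using step[of k] by blast
    have "\<exists>x\<in>B i. z = x * (u * y) \<and> x + u * y \<in> B i" if z: "z \<in> B (Suc k)" for z
    proof -
      obtain w where w: "z = w * y" "\<forall>j\<le>(P k)\<^sup>2. w + j * y \<in> B k"
        using y(3) z by blast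
      have "u \<le> P k"
        using u(2) pos[of i] by simp
      then have "u\<^sup>2 \<le> (P k)\<^sup>2"
        by (rule power_mono) simp
      then have "w + u\<^sup>2 * y \<in> B k"
        using w(2) by blast
      have "w \<in> B k"
        using spec[OF w(2), of 0] by simp
      obtain x' where x': "x' \<in> B i" "w + u\<^sup>2 * y = x' * u"
        using u(3) \<open>w + u\<^sup>2 * y \<in> B k\<close> by blast
      obtain x where x: "x \<in> B i" "w = x * u"
        using u(3) \<open>w \<in> B k\<close> by blast
      have "x' * u = w + u\<^sup>2 * y"
        by (rule x'(2)[symmetric])
      also have "\<dots> = (x + u * y) * u"
        by (simp add: x(2) power2_eq_square algebra_simps)
      finally have "x' = x + u * y"
        using u(1) by (simp only: mult_cancel2) simp
      moreover have "z = x * (u * y)"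
        using w(1) x(2) by (simp only: mult.assoc)
      ultimately show ?thesis
        using x(1) x'(1) by blast
    qed
    moreover have "0 < u * y" "P (Suc k) = P i * (u * y)"
      using u(1,2) y(1,2) by (simp_all only: mult.assoc nat_0_less_mult_iff)
    ultimately show ?thesis
      by blast
  qed
  show ?thesis
    using \<open>i < k\<close>
  proof (induction k)
    case (Suc k)
    show ?case
    proof (cases "i = k")
      case True
      show ?thesis
        unfolding True by (rule extend[of 1 k, unfolded True]) simp_all
    next
      case False
      then have "i < k"
        using Suc.prems by simp
      then obtain Y where "0 < Y" "P k = P i * Y" "\<forall>z\<in>B k. \<exists>x\<in>B i. z = x * Y \<and> x + Y \<in> B i"
        using Suc.IH by blast
      then show ?thesis using extend[of Y k] by blast
    qed
  qed simp
qed

theorem corollary1p5: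
  fixes r :: nat and C :: "nat \<Rightarrow> nat set"
  assumes "finite_coloring r C"
  shows "infinite {(x, y). x \<in> {1..} \<and> y \<in> {1..} \<and> monochromatic r C {x, x * y, x + y}}"
proof
  let ?S = "{(x, y). x \<in> {1..} \<and> y \<in> {1..} \<and> monochromatic r C {x, x * y, x + y}}"
  assume fin: "finite ?S"
  have col: "(\<Union>t\<in>{1..r}. C t) = {1..}"
    using assms by (simp add: finite_coloring_def)
  \<comment> \<open>A stage consists of the current set, the product of the multipliers so far and a colour. Keeping
    the product makes the choice of the next stage depend on the current one alone.\<close>
  define ok where "ok = (\<lambda>(B, P, t). piecewise_syndetic B \<and> 0 < (P::nat) \<and> t \<in> {1..r} \<and> B \<subseteq> C t)"
  define nxt where "nxt = (\<lambda>(B, P, t::nat) (B', P', t'::nat). \<exists>y>0. P' = P * y \<and>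
      (\<forall>z\<in>B'. \<exists>x. z = x * y \<and> (\<forall>j\<le>(P::nat)\<^sup>2. x + j * y \<in> B)))"
  obtain st where st: "\<And>k. ok (st k)" "\<And>k. nxt (st k) (st (Suc k))"
  proof -
    have "\<exists>s. ok s"
    proof -
      have "piecewise_syndetic (\<Union>t\<in>{1..r}. C t)"
        unfolding col by (rule piecewise_syndetic_atLeast)
      then obtain t where "t \<in> {1..r}" "piecewise_syndetic (C t)"
        using piecewise_syndetic_UN by blast
      then have "ok (C t, 1, t)"
        by (simp add: ok_def)
      then show ?thesis ..
    qed
    moreover have "\<exists>s'. ok s' \<and> nxt s s'" if s: "ok s" for s
    proof -
      obtain B P t where [simp]: "s = (B, P, t)"
        by (cases s)
      have B: "piecewise_syndetic B" "0 < P" "t \<in> {1..r}" "B \<subseteq> C t"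
        using s by (simp_all add: ok_def)
      then have "B \<subseteq> {1..}"
        using col by blast
      obtain y t' B' where y: "0 < y" "t' \<in> {1..r}" "B' \<subseteq> C t'" "piecewise_syndetic B'"
        "\<forall>z\<in>B'. \<exists>x. z = x * y \<and> (\<forall>j\<le>P\<^sup>2. x + j * y \<in> B)"
        using dilated_progressions_in_cell[OF col B(1) \<open>B \<subseteq> {1..}\<close>] by meson
      then have "ok (B', P * y, t')" "nxt s (B', P * y, t')"
        using B(2) by (auto simp: ok_def nxt_def)
      then show ?thesis by blast
    qed
    ultimately show ?thesis
      using dependent_nat_choice[of "\<lambda>_. ok" "\<lambda>_. nxt"] that by metis
  qed
  define B where "B k = fst (st k)" for k
  define P where "P k = fst (snd (st k))" for k
  define t where "t k = snd (snd (st k))" for k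
  have ok: "piecewise_syndetic (B k)" "0 < P k" "t k \<in> {1..r}" "B k \<subseteq> C (t k)" for k
    using st(1)[of k] by (simp_all add: ok_def B_def P_def t_def split_beta)
  have nxt: "\<exists>y>0. P (Suc k) = P k * y \<and>
      (\<forall>z\<in>B (Suc k). \<exists>x. z = x * y \<and> (\<forall>j\<le>(P k)\<^sup>2. x + j * y \<in> B k))" for k
    using st(2)[of k] by (simp add: nxt_def B_def P_def split_beta)
  have "finite (range t)"
    by (rule finite_subset[of _ "{1..r}"]) (use ok(3) in blast, simp)
  then have "\<not> inj t"
    using finite_imageD infinite_UNIV_nat by blast
  then obtain i k where ik: "i < k" "t i = t k"
    by (metis injI linorder_neqE_nat)
  obtain Y where Y: "0 < Y" "\<forall>z\<in>B k. \<exists>x\<in>B i. z = x * Y \<and> x + Y \<in> B i"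
    using sum_product_between_stages[where B = B and P = P, OF ok(2) nxt ik(1)] by blast
  have "B k \<subseteq> (\<lambda>(x, y). x * y) ` ?S"
  proof
    fix z assume z: "z \<in> B k"
    then obtain x where x: "x \<in> B i" "z = x * Y" "x + Y \<in> B i"
      using Y(2) by blast
    then have sub: "{x, x * Y, x + Y} \<subseteq> C (t k)"
      using z ok(4)[of k] ok(4)[of i] ik(2) by auto
    moreover have "x \<in> {1..}"
      using sub ok(3)[of k] col by blast
    ultimately have "(x, Y) \<in> ?S"
      using ok(3)[of k] Y(1) unfolding monochromatic_def by auto
    then show "z \<in> (\<lambda>(x, y). x * y) ` ?S"
      using x(2) by force
  qed
  then have "finite (B k)"
    using fin finite_surj by blast
  then show False
    using piecewise_syndetic_imp_infinite ok(1) by blast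
qed

end
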